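(* Let $d,k\in\mathbb{N}$. (i) If $k\ge 8$, then every $5$-dimensional grid is equitably $k$-list arborable. (ii) If $6\le d\le 16$ and $k\ge 2d-2+\frac{2d-4}{7}$, then every $d$-dimensional grid is equitably $k$-list arborable. (iii) If $d\ge 17$ and $k\ge 2d-3+\frac{2d-3}{6}$, then every $d$-dimensional grid is equitably $k$-list arborable.
   Context: $P_n$ denotes the path on $n$ vertices and $\square$ the Cartesian product of graphs. A $d$-dimensional grid is a graph $P_{n_1}\square\cdots\square P_{n_d}$ with every $n_i\ge 2$. A $k$-uniform list assignment $L$ for a graph $G$ assigns to each vertex $v$ a set $L(v)$ of exactly $k$ colours; an $L$-colouring is a map $c$ with $c(v)\in L(v)$ for all $v$; it is equitable if every colour class has at most $\lceil |V(G)|/k\rceil$ vertices. $G$ is equitably $k$-list arborable if for every $k$-uniform list assignment $L$ there is an equitable $L$-colouring of $G$ in which every colour class induces an acyclic subgraph. *)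

theory Defs
  imports Complex_Main "Graph_Theory.Graph_Theory"
begin

text \<open>
  An undirected simple graph is represented as a \<^typ>\<open>'a pair_pre_digraph\<close> whose arc relation is
  symmetric and irreflexive, so that every edge contributes its two orientations as arcs.
\<close>

definition path_graph :: "nat \<Rightarrow> nat pair_pre_digraph" where
  "path_graph n = \<lparr> pverts = {..<n},
     parcs = {(i, j). i < n \<and> j < n \<and> (j = Suc i \<or> i = Suc j)} \<rparr>"

text \<open>
  The Cartesian product of a list of graphs; a vertex is the list of its coordinates.
\<close>

definition cartesian_prod_verts :: "'a pair_pre_digraph list \<Rightarrow> 'a list set" where
  "cartesian_prod_verts Gs =
     {xs. length xs = length Gs \<and> (\<forall>i<length Gs. xs ! i \<in> pverts (Gs ! i))}"

definition cartesian_prod :: "'a pair_pre_digraph list \<Rightarrow> 'a list pair_pre_digraph" where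
  "cartesian_prod Gs = \<lparr> pverts = cartesian_prod_verts Gs,
     parcs = {(xs, ys). xs \<in> cartesian_prod_verts Gs \<and> ys \<in> cartesian_prod_verts Gs \<and>
       (\<exists>i<length Gs. (xs ! i, ys ! i) \<in> parcs (Gs ! i) \<and>
          (\<forall>j<length Gs. j \<noteq> i \<longrightarrow> xs ! j = ys ! j))} \<rparr>"

definition is_grid :: "nat \<Rightarrow> nat list pair_pre_digraph \<Rightarrow> bool" where
  "is_grid d G \<longleftrightarrow> (\<exists>ns. length ns = d \<and> (\<forall>n\<in>set ns. 2 \<le> n) \<and>
     G = cartesian_prod (map path_graph ns))"

text \<open>
  In the symmetric representation each edge \<open>{u, v}\<close> gives rise to the directed cycle \<open>u, v, u\<close>.
  The cycles of the undirected simple graph are the directed ones with at least three arcs;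
  the library predicate \<^const>\<open>forest\<close> also excludes those with two arcs and is therefore too strong.
\<close>

definition acyclic_graph :: "('a, 'b) pre_digraph \<Rightarrow> bool" where
  "acyclic_graph G \<longleftrightarrow> \<not> (\<exists>p. pre_digraph.cycle G p \<and> 3 \<le> length p)"

definition uniform_list_assignment ::
    "nat \<Rightarrow> 'a pair_pre_digraph \<Rightarrow> ('a \<Rightarrow> 'c set) \<Rightarrow> bool" where
  "uniform_list_assignment k G L \<longleftrightarrow> (\<forall>v\<in>pverts G. finite (L v) \<and> card (L v) = k)"

definition list_colouring :: "'a pair_pre_digraph \<Rightarrow> ('a \<Rightarrow> 'c set) \<Rightarrow> ('a \<Rightarrow> 'c) \<Rightarrow> bool" where
  "list_colouring G L c \<longleftrightarrow> (\<forall>v\<in>pverts G. c v \<in> L v)"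

definition colour_class :: "'a pair_pre_digraph \<Rightarrow> ('a \<Rightarrow> 'c) \<Rightarrow> 'c \<Rightarrow> 'a set" where
  "colour_class G c a = {v \<in> pverts G. c v = a}"

definition equitable_colouring :: "nat \<Rightarrow> 'a pair_pre_digraph \<Rightarrow> ('a \<Rightarrow> 'c) \<Rightarrow> bool" where
  "equitable_colouring k G c \<longleftrightarrow>
     (\<forall>a. int (card (colour_class G c a)) \<le> \<lceil>real (card (pverts G)) / real k\<rceil>)"

text \<open>
  The extra argument fixes the type from which colours are drawn. For a finite \<^term>\<open>G\<close> all
  infinite colour types yield the same notion, and it implies the one for any other colour type.
\<close>

definition equitably_list_arborable :: "'c itself \<Rightarrow> nat \<Rightarrow> 'a pair_pre_digraph \<Rightarrow> bool" where
  "equitably_list_arborable (_ :: 'c itself) k G \<longleftrightarrow>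
     (\<forall>L :: 'a \<Rightarrow> 'c set. uniform_list_assignment k G L \<longrightarrow>
        (\<exists>c. list_colouring G L c \<and> equitable_colouring k G c \<and>
          (\<forall>a. acyclic_graph (with_proj G \<restriction> colour_class G c a))))"

end

theory Submission
  imports Defs
begin

text \<open>
  Colour the vertices one at a time, keeping every class acyclic and of size at most
  \<open>s = \<lceil>n / k\<rceil>\<close>. A vertex may enter a class in which it has at most one neighbour.
  Suppose a new vertex \<open>x\<close> cannot be coloured, even after shifting vertices along a path of colours
  towards a class with fewer than \<open>s\<close> vertices. Let \<open>B\<close> be the set of the \<open>b\<close> colours from which no
  such shift starts; their classes are full. Then \<open>x\<close> and every vertex coloured from \<open>B\<close> has two
  neighbours in the class of every colour of its list outside \<open>B\<close>, and there are at least \<open>k - b\<close> of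
  these. If every vertex has at most \<open>D\<close> neighbours and \<open>x\<close> has at most \<open>e\<close> coloured ones, then
  \<open>2 (k - b) \<le> e\<close>, and counting the edges that leave the classes of \<open>B\<close> gives
  \<open>2 (k - b) b s \<le> D \<cdot> (number of vertices outside) < D (k - b) s\<close>, so \<open>2 b < D\<close>. Hence there is no
  obstruction once \<open>D + e \<le> 2 k\<close>. In a grid \<open>D = 2 d\<close>, and inserting vertices so that the new one has
  the largest coordinate sum gives \<open>e = d\<close>; every case of the theorem satisfies \<open>3 d \<le> 2 k\<close>.
\<close>

section \<open>Recolouring\<close>

text \<open>\<open>P\<close> abstracts inducing a forest and \<open>N\<close> the neighbourhood in a
  simple graph. The shifting argument uses forests only through heredity and through adding a vertex
  with at most one neighbour.\<close>

locale recolouring =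
  fixes N :: "'a \<Rightarrow> 'a set" and P :: "'a set \<Rightarrow> bool" and L :: "'a \<Rightarrow> 'c set" and s :: nat
  assumes N_sym: "w \<in> N v \<longleftrightarrow> v \<in> N w"
    and P_empty: "P {}"
    and P_subset: "P T \<Longrightarrow> S \<subseteq> T \<Longrightarrow> P S"
    and P_insert: "finite S \<Longrightarrow> P S \<Longrightarrow> card (N v \<inter> S) \<le> 1 \<Longrightarrow> P (insert v S)"
    and s_pos: "0 < s"
begin

definition cls :: "'a set \<Rightarrow> ('a \<Rightarrow> 'c) \<Rightarrow> 'c \<Rightarrow> 'a set" where
  "cls U c a = {u \<in> U. c u = a}"

definition valid :: "'a set \<Rightarrow> ('a \<Rightarrow> 'c) \<Rightarrow> bool" where
  "valid U c \<longleftrightarrow> (\<forall>u\<in>U. c u \<in> L u) \<and> (\<forall>a. P (cls U c a) \<and> card (cls U c a) \<le> s)"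

definition movable :: "'a set \<Rightarrow> ('a \<Rightarrow> 'c) \<Rightarrow> 'c \<Rightarrow> 'c \<Rightarrow> bool" where
  "movable U c a b \<longleftrightarrow> (\<exists>w\<in>U. c w = a \<and> b \<in> L w \<and> card (N w \<inter> cls U c b) \<le> 1)"

definition accessible :: "'a set \<Rightarrow> ('a \<Rightarrow> 'c) \<Rightarrow> 'c set" where
  "accessible U c = {a. \<exists>p. p \<noteq> [] \<and> hd p = a \<and> distinct p \<and> successively (movable U c) p \<and>
     card (cls U c (last p)) < s}"

lemma finite_cls [simp]: "finite U \<Longrightarrow> finite (cls U c a)"
  by (simp add: cls_def)

text \<open>Only the class of \<open>a\<close> grows; all others can only shrink. Since
  \<open>x\<close> may lie in \<open>U\<close>, the same update serves to colour a new vertex and to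
  move a coloured one.\<close>

lemma valid_insert_update:
  assumes "finite U" "valid U c" "a \<in> L x" "card (N x \<inter> cls U c a) \<le> 1" "card (cls U c a) < s"
  shows "valid (insert x U) (c(x := a))"
proof -
  have cls_a: "cls (insert x U) (c(x := a)) a = insert x (cls U c a)"
    by (auto simp: cls_def)
  have cls_sub: "cls (insert x U) (c(x := a)) b \<subseteq> cls U c b" if "b \<noteq> a" for b
    using that by (auto simp: cls_def)
  have "P (cls (insert x U) (c(x := a)) b) \<and> card (cls (insert x U) (c(x := a)) b) \<le> s" for b
  proof (cases "b = a")
    case True
    have "card (insert x (cls U c a)) \<le> s"
      using assms(1,5) by (simp add: card_insert_if)
    moreover have "P (insert x (cls U c a))"
      using assms P_insert by (simp add: valid_def)
    ultimately show ?thesis using True cls_a by simp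
  next
    case False
    have "card (cls (insert x U) (c(x := a)) b) \<le> card (cls U c b)"
      using cls_sub[OF False] assms(1) by (intro card_mono) auto
    then show ?thesis
      using P_subset[OF _ cls_sub[OF False]] assms(2) by (auto simp: valid_def intro: order_trans)
  qed
  then show ?thesis using assms(2,3) by (auto simp: valid_def)
qed

text \<open>The last move of the path is made first; as the colours of the path are distinct, the earlier
  moves remain possible.\<close>

lemma shift_along_path:
  assumes "finite U" "p \<noteq> []" "distinct p" "valid U c" "successively (movable U c) p"
    "card (cls U c (last p)) < s"
  shows "\<exists>c'. valid U c' \<and> cls U c' (hd p) \<subseteq> cls U c (hd p) \<and> card (cls U c' (hd p)) < s"
  using assms
proof (induction p arbitrary: c rule: rev_induct)
  case Nil
  then show ?case by simp
next
  case (snoc b q)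
  show ?case
  proof (cases "q = []")
    case True
    then show ?thesis using snoc.prems by auto
  next
    case False
    have path: "successively (movable U c) q" and "movable U c (last q) b"
      using snoc.prems False by (auto simp: successively_append_iff)
    then obtain w where w: "w \<in> U" "c w = last q" "b \<in> L w" "card (N w \<inter> cls U c b) \<le> 1"
      by (auto simp: movable_def)
    have b: "b \<notin> set q" and q: "distinct q" using snoc.prems by auto
    define c1 where "c1 = c(w := b)"
    have valid: "valid U c1"
      using valid_insert_update[OF snoc.prems(1,4) w(3,4)] snoc.prems(6) w(1)
      by (simp add: c1_def insert_absorb)
    have sub: "cls U c1 a \<subseteq> cls U c a" if "a \<in> set q" for a
      using that b by (auto simp: c1_def cls_def)
    have "movable U c1 (q ! i) (q ! Suc i)" if i: "Suc i < length q" for i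
    proof -
      have "movable U c (q ! i) (q ! Suc i)"
        using path i by (simp add: successively_conv_nth)
      then obtain v where v: "v \<in> U" "c v = q ! i" "q ! Suc i \<in> L v"
        "card (N v \<inter> cls U c (q ! Suc i)) \<le> 1"
        by (auto simp: movable_def)
      have "q ! i \<noteq> last q"
        using q i False by (simp add: last_conv_nth nth_eq_iff_index_eq)
      then have "v \<noteq> w" using v w by auto
      moreover have "card (N v \<inter> cls U c1 (q ! Suc i)) \<le> card (N v \<inter> cls U c (q ! Suc i))"
        using sub[of "q ! Suc i"] i snoc.prems(1) by (intro card_mono) auto
      ultimately have "c1 v = q ! i" "card (N v \<inter> cls U c1 (q ! Suc i)) \<le> 1"
        using v by (simp_all add: c1_def)
      then show ?thesis using v(1,3) unfolding movable_def by blast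
    qed
    then have path1: "successively (movable U c1) q"
      by (simp add: successively_conv_nth)
    \<comment> \<open>Losing \<open>w\<close> makes room in the class of \<open>last q\<close>, so
      the shorter path \<open>q\<close> again ends in a class that is not full.\<close>
    have "w \<in> cls U c (last q)" "w \<notin> cls U c1 (last q)"
      using w b False by (auto simp: cls_def c1_def)
    then have "cls U c1 (last q) \<subset> cls U c (last q)"
      using sub[OF last_in_set[OF False]] by blast
    then have "card (cls U c1 (last q)) < card (cls U c (last q))"
      using snoc.prems(1) by (intro psubset_card_mono) auto
    also have "\<dots> \<le> s" using snoc.prems by (simp add: valid_def)
    finally obtain c' where "valid U c'" "cls U c' (hd q) \<subseteq> cls U c1 (hd q)"
        "card (cls U c' (hd q)) < s"
      using snoc.IH[OF snoc.prems(1) False q valid path1] by blast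
    moreover have "hd (q @ [b]) = hd q" using False by simp
    ultimately show ?thesis using sub[OF hd_in_set[OF False]] by (metis subset_trans)
  qed
qed

lemma not_full_accessible: "card (cls U c a) < s \<Longrightarrow> a \<in> accessible U c"
  unfolding accessible_def by (intro CollectI exI[of _ "[a]"]) auto

lemma movable_accessible:
  assumes "movable U c a b" "b \<in> accessible U c"
  shows "a \<in> accessible U c"
proof -
  obtain p where p: "p \<noteq> []" "hd p = b" "distinct p" "successively (movable U c) p"
      "card (cls U c (last p)) < s"
    using assms by (auto simp: accessible_def)
  show ?thesis
  proof (cases "a \<in> set p")
    \<comment> \<open>Prepending \<open>a\<close> would break distinctness; the part of the path
      from \<open>a\<close> onwards serves instead.\<close>
    case True
    then obtain q r where "p = q @ a # r" by (auto simp: in_set_conv_decomp)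
    then show ?thesis using p unfolding accessible_def
      by (intro CollectI exI[of _ "a # r"]) (auto simp: successively_append_iff)
  next
    case False
    then show ?thesis using p assms(1) unfolding accessible_def
      by (intro CollectI exI[of _ "a # p"]) (auto simp: successively_Cons)
  qed
qed

text \<open>The new vertex bounds \<open>k - card B\<close> through \<open>e\<close>, and double
  counting the edges between \<open>VB\<close> and \<open>VA\<close> bounds \<open>card B\<close>
  through \<open>D\<close>; together the bounds contradict \<open>D + e \<le> 2 * k\<close>.\<close>

lemma extend_colouring:
  assumes fin: "finite U" and valid: "valid U c" and x: "x \<notin> U"
    and card_U: "card U < s * k"
    and L: "\<And>u. u \<in> insert x U \<Longrightarrow> finite (L u) \<and> card (L u) = k"
    and D: "\<And>u. u \<in> U \<Longrightarrow> card (N u \<inter> U) \<le> D" "0 < D"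
    and e: "card (N x \<inter> U) \<le> e"
    and De: "D + e \<le> 2 * k"
  shows "\<exists>c'. valid (insert x U) c'"
proof (rule ccontr)
  assume stuck: "\<nexists>c'. valid (insert x U) c'"
  define A where "A = accessible U c"
  define B where "B = - A"
  define VB where "VB = {u \<in> U. c u \<in> B}"
  define VA where "VA = U - VB"
  have full: "card (cls U c a) = s" if "a \<in> B" for a
  proof -
    have "\<not> card (cls U c a) < s"
      using that not_full_accessible[of U c a] by (auto simp: B_def A_def)
    moreover have "card (cls U c a) \<le> s" using valid by (simp add: valid_def)
    ultimately show ?thesis by simp
  qed
  \<comment> \<open>\<open>B\<close> is a complement in a possibly infinite type of colours. Its
    classes have \<open>s > 0\<close> vertices, so its colours all occur and it is finite.\<close>
  have "B \<subseteq> c ` U"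
  proof
    fix a assume "a \<in> B"
    then have "cls U c a \<noteq> {}" using full s_pos by force
    then show "a \<in> c ` U" by (auto simp: cls_def)
  qed
  then have finB: "finite B" using fin finite_surj by blast
  have "VB = (\<Union>a\<in>B. cls U c a)" by (auto simp: VB_def cls_def)
  then have "card VB = (\<Sum>a\<in>B. card (cls U c a))"
    using finB fin by (simp, intro card_UN_disjoint) (auto simp: cls_def)
  then have card_VB: "card VB = card B * s" using full by simp
  have "VB \<subseteq> U" by (auto simp: VB_def)
  then have card_VA: "card U = card B * s + card VA"
    using fin card_VB card_mono[OF fin, of VB]
    by (simp add: VA_def card_Diff_subset finite_subset)
  have finV: "finite VA" "finite VB" using fin by (auto simp: VA_def VB_def)
  have "card U < k * s" using card_U by (simp add: mult.commute)
  then have "card B * s < k * s" using card_VA by linarith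
  then have bk: "card B < k" by simp
  \<comment> \<open>The list of \<open>y\<close> has at least \<open>k - card B\<close> colours
    outside \<open>B\<close>; their classes are disjoint parts of \<open>VA\<close>, each with two
    neighbours of \<open>y\<close>. This serves both \<open>x\<close> and the vertices of
    \<open>VB\<close>.\<close>
  have blocked: "2 * (k - card B) \<le> card (N y \<inter> VA)"
    if "y \<in> insert x U" and two: "\<And>a. a \<in> L y \<Longrightarrow> a \<in> A \<Longrightarrow> 2 \<le> card (N y \<inter> cls U c a)" for y
  proof -
    have "k - card B \<le> card (L y - B)"
      using L[OF that(1)] diff_card_le_card_Diff[OF finB, of "L y"] by simp
    then have "2 * (k - card B) \<le> (\<Sum>a\<in>L y - B. 2)" by simp
    also have "\<dots> \<le> (\<Sum>a\<in>L y - B. card (N y \<inter> cls U c a))"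
      using two by (intro sum_mono) (auto simp: B_def)
    also have "\<dots> = card (\<Union>a\<in>L y - B. N y \<inter> cls U c a)"
      using L[OF that(1)] fin by (intro card_UN_disjoint[symmetric]) (auto simp: cls_def)
    also have "\<dots> \<le> card (N y \<inter> VA)"
      using finV by (intro card_mono) (auto simp: cls_def VA_def VB_def)
    finally show ?thesis .
  qed
  have two_x: "2 \<le> card (N x \<inter> cls U c a)" if "a \<in> L x" "a \<in> A" for a
  proof (rule ccontr)
    assume "\<not> 2 \<le> card (N x \<inter> cls U c a)"
    then have le1: "card (N x \<inter> cls U c a) \<le> 1" by simp
    \<comment> \<open>Shifting makes room in class \<open>a\<close> and only removes vertices from
      it, so \<open>x\<close> still has at most one neighbour there and could be coloured
      \<open>a\<close>.\<close>
    obtain c' where c': "valid U c'" "cls U c' a \<subseteq> cls U c a" "card (cls U c' a) < s"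
      using \<open>a \<in> A\<close> shift_along_path[OF fin _ _ valid] unfolding A_def accessible_def by blast
    have "card (N x \<inter> cls U c' a) \<le> card (N x \<inter> cls U c a)"
      using c' fin by (intro card_mono) auto
    then show False
      using stuck valid_insert_update[OF fin c'(1) \<open>a \<in> L x\<close> _ c'(3)] le1 by auto
  qed
  have "2 * (k - card B) \<le> card (N x \<inter> VA)"
    using blocked[of x] two_x by auto
  also have "\<dots> \<le> card (N x \<inter> U)"
    using fin by (intro card_mono) (auto simp: VA_def)
  finally have ke: "2 * (k - card B) \<le> e" using e by simp
  have deg_B: "2 * (k - card B) \<le> card {z \<in> VA. z \<in> N y}" if "y \<in> VB" for y
  proof -
    have y: "y \<in> U" "c y \<in> B" using that by (auto simp: VB_def)
    have "2 \<le> card (N y \<inter> cls U c a)" if "a \<in> L y" "a \<in> A" for a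
    proof (rule ccontr)
      \<comment> \<open>Otherwise \<open>y\<close> could move into an accessible class, which would
        make its own colour accessible.\<close>
      assume "\<not> 2 \<le> card (N y \<inter> cls U c a)"
      then have "card (N y \<inter> cls U c a) \<le> 1" by simp
      then have "movable U c (c y) a" unfolding movable_def using that(1) y(1) by blast
      then show False using movable_accessible that(2) y(2) unfolding A_def B_def by blast
    qed
    then have "2 * (k - card B) \<le> card (N y \<inter> VA)"
      using blocked[of y] y by simp
    also have "N y \<inter> VA = {z \<in> VA. z \<in> N y}" by auto
    finally show ?thesis .
  qed
  have deg_A: "card {y \<in> VB. z \<in> N y} \<le> D" if "z \<in> VA" for z
  proof -
    have "card {y \<in> VB. z \<in> N y} \<le> card (N z \<inter> U)"
      using fin N_sym by (intro card_mono) (auto simp: VB_def)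
    then show ?thesis using D(1)[of z] that by (auto simp: VA_def)
  qed
  have "2 * (k - card B) * (card B * s) = (\<Sum>y\<in>VB. 2 * (k - card B))"
    by (simp add: card_VB)
  also have "\<dots> \<le> (\<Sum>y\<in>VB. card {z \<in> VA. z \<in> N y})"
    using deg_B by (rule sum_mono)
  also have "\<dots> = (\<Sum>z\<in>VA. card {y \<in> VB. z \<in> N y})"
    using finV by (intro sum_multicount_gen) auto
  also have "\<dots> \<le> D * card VA"
    using deg_A sum_bounded_above[of VA "\<lambda>z. card {y \<in> VB. z \<in> N y}" D] by (simp add: mult.commute)
  also have "\<dots> < D * ((k - card B) * s)"
  proof -
    \<comment> \<open>The strictness comes from \<open>card U < s * k\<close>, that is, from the new
      vertex still having a place.\<close>
    have "card VA < (k - card B) * s"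
      using card_VA \<open>card U < k * s\<close> unfolding diff_mult_distrib by linarith
    then show ?thesis using D(2) by simp
  qed
  finally have "((k - card B) * s) * (2 * card B) < ((k - card B) * s) * D"
    by (simp add: algebra_simps)
  then have "2 * card B < D" by simp
  then show False using ke De bk by linarith
qed

text \<open>Induction on subsets of \<open>V\<close>, each time removing a vertex given by
  \<open>degenerate\<close>. The bound \<open>s\<close> stays fixed, so smaller subsets are coloured
  with the class size allowed for \<open>V\<close>.\<close>

theorem equitable_colouring_exists:
  assumes "finite V" "card V \<le> s * k"
    and L: "\<And>u. u \<in> V \<Longrightarrow> finite (L u) \<and> card (L u) = k"
    and D: "\<And>u. u \<in> V \<Longrightarrow> card (N u \<inter> V) \<le> D" "0 < D"
    and degenerate: "\<And>U. U \<subseteq> V \<Longrightarrow> U \<noteq> {} \<Longrightarrow> \<exists>x\<in>U. card (N x \<inter> U) \<le> e"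
    and De: "D + e \<le> 2 * k"
  shows "\<exists>c. valid V c"
proof -
  have "\<exists>c. valid U c" if "U \<subseteq> V" for U
    using finite_subset[OF that assms(1)] that
  proof (induction U rule: finite_psubset_induct)
    case (psubset U)
    show ?case
    proof (cases "U = {}")
      case True
      then show ?thesis by (simp add: valid_def cls_def P_empty)
    next
      case False
      then obtain x where x: "x \<in> U" "card (N x \<inter> U) \<le> e"
        using degenerate psubset.prems by blast
      let ?W = "U - {x}"
      have W: "finite ?W" "insert x ?W = U" using psubset.hyps x by auto
      obtain c where c: "valid ?W c" using psubset.IH[of ?W] psubset.prems x by auto
      have "card ?W < card U" using psubset.hyps x by (intro psubset_card_mono) auto
      also have "\<dots> \<le> s * k" using card_mono[OF assms(1) psubset.prems] assms(2) by simp
      finally have "card ?W < s * k" .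
      moreover have "card (N u \<inter> ?W) \<le> D" if "u \<in> ?W" for u
      proof -
        have "card (N u \<inter> ?W) \<le> card (N u \<inter> V)"
          using assms(1) psubset.prems by (intro card_mono) auto
        then show ?thesis using D(1)[of u] that psubset.prems by auto
      qed
      moreover have "card (N x \<inter> ?W) \<le> e"
      proof -
        have "card (N x \<inter> ?W) \<le> card (N x \<inter> U)"
          using psubset.hyps by (intro card_mono) auto
        then show ?thesis using x by simp
      qed
      ultimately have "\<exists>c'. valid (insert x ?W) c'"
        using L psubset.prems W x D(2) De
        by (intro extend_colouring[OF W(1) c, of x k D e]) auto
      then show ?thesis using W by simp
    qed
  qed
  then show ?thesis by blast
qed

end

section \<open>Acyclic induced subgraphs\<close>

lemma cas_nth:
  assumes "pre_digraph.cas (with_proj G) u p v" "Suc i < length p"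
  shows "snd (p ! i) = fst (p ! Suc i)"
  using assms
proof (induction p arbitrary: u i)
  case Nil
  then show ?case by simp
next
  case (Cons e p)
  then show ?case
    by (cases i; cases p) (auto simp: pre_digraph.cas.simps simp del: cas_with_proj_eq)
qed

lemma cas_ends_nth:
  assumes "pre_digraph.cas (with_proj G) u p v" "p \<noteq> []"
  shows "fst (hd p) = u" "snd (last p) = v"
  using assms
  by (induction p arbitrary: u) (auto simp: pre_digraph.cas.simps simp del: cas_with_proj_eq)

text \<open>Cyclic indexing gives every arc of a cycle a predecessor and a successor, wherever the
  closed walk happens to start.\<close>

lemma cycle_inducedD:
  assumes "pre_digraph.cycle (with_proj G \<restriction> S) p"
  shows "set p \<subseteq> parcs G \<inter> S \<times> S" "distinct (map snd p)"
    "\<And>i. i < length p \<Longrightarrow> snd (p ! i) = fst (p ! (Suc i mod length p))"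
proof -
  interpret pre_digraph "with_proj G \<restriction> S" .
  obtain u where u: "awalk u p u" "distinct (tl (awalk_verts u p))" "p \<noteq> []"
    using assms by (auto simp: cycle_def)
  show "set p \<subseteq> parcs G \<inter> S \<times> S" using u(1) by (auto simp: awalk_def)
  have cas: "cas u p u" using u(1) by (simp add: awalk_def)
  then show "distinct (map snd p)" using u(2,3) awalk_verts_conv'[OF cas] by simp
  have "pre_digraph.cas (with_proj G) x q y = cas x q y" for x q y
    by (induction q arbitrary: x) (auto simp: pre_digraph.cas.simps simp del: cas_with_proj_eq)
  then have cas': "pre_digraph.cas (with_proj G) u p u" using cas by simp
  show "snd (p ! i) = fst (p ! (Suc i mod length p))" if "i < length p" for i
  proof (cases "Suc i = length p")
    case True
    then have "p ! i = last p" "p ! 0 = hd p"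
      using u(3) by (simp_all add: last_conv_nth hd_conv_nth flip: True)
    then show ?thesis using cas_ends_nth[OF cas' u(3)] True by simp
  next
    case False
    then show ?thesis using cas_nth[OF cas'] that by simp
  qed
qed

lemma acyclic_graph_empty: "acyclic_graph (with_proj G \<restriction> {})"
  using cycle_inducedD(1)[of G "{}"] by (fastforce simp: acyclic_graph_def)

text \<open>The condition concerns the arcs of \<open>p\<close>, not \<open>S\<close>, so a cycle
  can be carried to a larger vertex set and also to a smaller one that still contains it.\<close>

lemma cycle_induced_mono:
  assumes "pre_digraph.cycle (with_proj G \<restriction> S) p" "set p \<subseteq> T \<times> T"
  shows "pre_digraph.cycle (with_proj G \<restriction> T) p"
proof -
  have cas: "pre_digraph.cas (with_proj G \<restriction> S) x q y = pre_digraph.cas (with_proj G \<restriction> T) x q y"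
    for x q y
    by (induction q arbitrary: x) (auto simp: pre_digraph.cas.simps)
  obtain u where u: "pre_digraph.awalk (with_proj G \<restriction> S) u p u"
      "distinct (tl (pre_digraph.awalk_verts (with_proj G \<restriction> S) u p))" "p \<noteq> []"
    using assms by (auto simp: pre_digraph.cycle_def)
  have "pre_digraph.awalk (with_proj G \<restriction> T) u p u"
    using u(1,3) assms(2) cas unfolding pre_digraph.awalk_def
    by (cases p) (auto simp: pre_digraph.cas.simps)
  moreover have "distinct (tl (pre_digraph.awalk_verts (with_proj G \<restriction> T) u p))"
    using u(2,3) by (simp add: pre_digraph.awalk_verts_conv)
  ultimately show ?thesis using u(3) by (auto simp: pre_digraph.cycle_def)
qed

lemma acyclic_graph_subset:
  assumes "acyclic_graph (with_proj G \<restriction> T)" "S \<subseteq> T"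
  shows "acyclic_graph (with_proj G \<restriction> S)"
  using assms cycle_induced_mono[of G S _ T] cycle_inducedD(1)[of G S]
  unfolding acyclic_graph_def by blast

text \<open>A new cycle must pass through \<open>v\<close>, entering and leaving by two different
  neighbours in \<open>S\<close>.\<close>

lemma acyclic_graph_insert:
  assumes "sym (parcs G)" "finite S" "acyclic_graph (with_proj G \<restriction> S)"
    "card ({w. (v, w) \<in> parcs G} \<inter> S) \<le> 1"
  shows "acyclic_graph (with_proj G \<restriction> insert v S)"
  unfolding acyclic_graph_def
proof safe
  fix p assume cyc: "pre_digraph.cycle (with_proj G \<restriction> insert v S) p" and len: "3 \<le> length p"
  note cyc' = cycle_inducedD[OF cyc]
  define m where "m = length p"
  have arc: "p ! i \<in> parcs G \<and> p ! i \<in> insert v S \<times> insert v S" if "i < m" for i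
    using subsetD[OF cyc'(1) nth_mem[of i p]] that unfolding m_def by blast
  have inj: "i = j" if "snd (p ! i) = snd (p ! j)" "i < m" "j < m" for i j
    using that cyc'(2) by (auto simp: distinct_conv_nth m_def)
  have "\<exists>i<m. snd (p ! i) = v"
  proof (rule ccontr)
    assume "\<not> (\<exists>i<m. snd (p ! i) = v)"
    then have no: "snd (p ! i) \<noteq> v" if "i < m" for i using that by blast
    have "fst (p ! i) \<noteq> v" if "i < m" for i
    proof -
      \<comment> \<open>\<open>(i + m - 1) mod m\<close> is the cyclic predecessor of
        \<open>i\<close>; adding \<open>m\<close> first avoids truncation at
        \<open>i = 0\<close>.\<close>
      have "snd (p ! ((i + m - 1) mod m)) = fst (p ! (Suc ((i + m - 1) mod m) mod m))"
        using cyc'(3)[of "(i + m - 1) mod m", folded m_def] that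
        by (metis mod_less_divisor not_less_zero neq0_conv)
      also have "Suc ((i + m - 1) mod m) mod m = i"
        using that by (simp add: mod_Suc_eq)
      finally show ?thesis using no[of "(i + m - 1) mod m"] that by simp
    qed
    then have "set p \<subseteq> S \<times> S"
      using arc no by (fastforce simp: m_def in_set_conv_nth)
    then have "pre_digraph.cycle (with_proj G \<restriction> S) p" by (rule cycle_induced_mono[OF cyc])
    then show False using assms(3) len by (auto simp: acyclic_graph_def)
  qed
  then obtain i where i: "i < m" "snd (p ! i) = v" by blast
  define j where "j = Suc i mod m"
  define h where "h = (i + m - 1) mod m"
  have m: "3 \<le> m" using len by (simp add: m_def)
  have jh: "j < m" "h < m" using m by (auto simp: j_def h_def)
  \<comment> \<open>Here \<open>3 \<le> m\<close> matters: for \<open>m = 2\<close> the predecessor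
    \<open>h\<close> and the successor \<open>j\<close> coincide, as in the two-arc cycle of a
    single edge.\<close>
  have ne: "j \<noteq> i" "h \<noteq> i" "h \<noteq> j"
    using i m by (auto simp: j_def h_def mod_Suc mod_if split: if_splits)
  have fst_i: "fst (p ! i) = snd (p ! h)"
  proof -
    have "Suc h mod m = i" using i m by (simp add: h_def mod_Suc_eq)
    then show ?thesis using cyc'(3)[of h] jh by (simp add: m_def)
  qed
  have fst_j: "fst (p ! j) = v" using cyc'(3)[of i] i by (simp add: j_def m_def)
  have a: "(v, snd (p ! j)) \<in> parcs G" "(v, snd (p ! h)) \<in> parcs G"
    using arc[OF jh(1)] arc[OF i(1)] fst_i fst_j i(2) assms(1)
    by (metis prod.collapse, metis prod.collapse symD)
  have b: "snd (p ! j) \<in> S" "snd (p ! h) \<in> S"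
    using arc[OF jh(1)] arc[OF jh(2)] inj[of j i] inj[of h i] jh i ne by (auto simp: mem_Times_iff)
  have "snd (p ! j) \<noteq> snd (p ! h)" using inj[of j h] jh ne by auto
  moreover have "{snd (p ! j), snd (p ! h)} \<subseteq> {w. (v, w) \<in> parcs G} \<inter> S" using a b by auto
  then have "card {snd (p ! j), snd (p ! h)} \<le> 1"
    using assms(2,4) by (meson card_mono finite_Int le_trans)
  ultimately show False by simp
qed

section \<open>Grids\<close>

lemma finite_cartesian_prod_verts:
  assumes "\<And>H. H \<in> set Gs \<Longrightarrow> finite (pverts H)"
  shows "finite (cartesian_prod_verts Gs)"
proof -
  have "cartesian_prod_verts Gs \<subseteq> {xs. set xs \<subseteq> (\<Union>H\<in>set Gs. pverts H) \<and> length xs = length Gs}"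
    by (fastforce simp: cartesian_prod_verts_def in_set_conv_nth)
  then show ?thesis
    using finite_lists_length_eq[of "\<Union>H\<in>set Gs. pverts H" "length Gs"] assms finite_subset by blast
qed

text \<open>A coordinate and a direction determine the neighbour, which bounds degrees; the
  coordinate sums tell the two directions apart, which gives degeneracy.\<close>

lemma grid_arcD:
  assumes "G = cartesian_prod (map path_graph ns)" "(x, y) \<in> parcs G"
  obtains i where "i < length ns" "y = x[i := Suc (x ! i)]" "sum_list y = Suc (sum_list x)"
  | i where "i < length ns" "y = x[i := x ! i - 1]" "sum_list x = Suc (sum_list y)"
proof -
  obtain i where i: "i < length ns" "y ! i = Suc (x ! i) \<or> x ! i = Suc (y ! i)"
    "\<And>j. j < length ns \<Longrightarrow> j \<noteq> i \<Longrightarrow> x ! j = y ! j" and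
    len: "length x = length ns" "length y = length ns"
    using assms by (auto simp: cartesian_prod_def cartesian_prod_verts_def path_graph_def)
  have y: "y = x[i := y ! i]"
    using i len by (intro nth_equalityI) (auto simp: nth_list_update)
  have le: "x ! i \<le> sum_list x"
    using i len by (intro member_le_sum_list) auto
  have "sum_list y = sum_list x + y ! i - x ! i"
    using sum_list_update[of i x "y ! i"] i(1) len y by simp
  then have sum: "sum_list y + x ! i = sum_list x + y ! i"
    using le by simp
  show thesis
    using i(2)
  proof
    assume "y ! i = Suc (x ! i)"
    then show thesis using that(1)[of i] i(1) y sum by simp
  next
    assume "x ! i = Suc (y ! i)"
    then show thesis using that(2)[of i] i(1) y sum by simp
  qed
qed

text \<open>\<open>3 * d \<le> 2 * k\<close> is the condition \<open>D + e \<le> 2 * k\<close> for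
  \<open>D = 2 * d\<close> and \<open>e = d\<close>.\<close>

lemma grid_equitably_list_arborable:
  assumes "is_grid d G" "0 < d" "3 * d \<le> 2 * k"
  shows "equitably_list_arborable TYPE('c) k G"
  unfolding equitably_list_arborable_def
proof (intro allI impI)
  fix L :: "nat list \<Rightarrow> 'c set"
  assume L: "uniform_list_assignment k G L"
  obtain ns where ns: "length ns = d" "\<And>n. n \<in> set ns \<Longrightarrow> 2 \<le> n"
    and G: "G = cartesian_prod (map path_graph ns)"
    using assms(1) by (auto simp: is_grid_def)
  define V where "V = pverts G"
  define N where "N = (\<lambda>v. {w. (v, w) \<in> parcs G})"
  define s where "s = nat \<lceil>real (card V) / real k\<rceil>"
  have k: "0 < k" using assms by simp
  have "finite (cartesian_prod_verts (map path_graph ns))"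
    by (rule finite_cartesian_prod_verts) (auto simp: path_graph_def)
  then have finV: "finite V"
    by (simp add: V_def G cartesian_prod_def)
  have "0 < ns ! i" if "i < d" for i
    using ns(2)[of "ns ! i"] ns(1) that by simp
  then have "replicate d 0 \<in> V"
    using ns(1) by (auto simp: V_def G cartesian_prod_def cartesian_prod_verts_def path_graph_def)
  then have "0 < card V" using finV by (auto simp: card_gt_0_iff)
  then have s: "0 < s" using k by (simp add: s_def)
  have "real (card V) / real k \<le> real s" unfolding s_def by (simp add: of_nat_ceiling)
  then have "real (card V) \<le> real (s * k)" using k by (simp add: field_simps)
  then have card_V: "card V \<le> s * k" by (simp only: of_nat_le_iff)
  have sym: "sym (parcs G)"
    unfolding G cartesian_prod_def path_graph_def by (rule symI) fastforce
  interpret recolouring N "\<lambda>S. acyclic_graph (with_proj G \<restriction> S)" L s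
  proof
    show "w \<in> N v \<longleftrightarrow> v \<in> N w" for v w using sym by (auto simp: N_def dest: symD)
    show "acyclic_graph (with_proj G \<restriction> insert v S)"
      if "finite S" "acyclic_graph (with_proj G \<restriction> S)" "card (N v \<inter> S) \<le> 1" for S v
      using acyclic_graph_insert[OF sym] that by (simp add: N_def)
  qed (use acyclic_graph_empty acyclic_graph_subset s in auto)
  \<comment> \<open>\<open>up\<close> and \<open>down\<close> may contain lists outside the grid,
    and \<open>down x\<close> contains \<open>x\<close> itself if some coordinate is 0; they serve
    only as upper bounds for neighbourhoods.\<close>
  define up where "up = (\<lambda>x :: nat list. (\<lambda>i. x[i := Suc (x ! i)]) ` {..<d})"
  define down where "down = (\<lambda>x :: nat list. (\<lambda>i. x[i := x ! i - 1]) ` {..<d})"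
  have card_ud: "card (up x) \<le> d" "card (down x) \<le> d" "finite (up x)" "finite (down x)" for x
    using card_image_le[of "{..<d}"] by (auto simp: up_def down_def)
  have deg: "card (N x \<inter> V) \<le> 2 * d" for x
  proof -
    have "N x \<subseteq> up x \<union> down x"
      using ns(1) by (auto simp: N_def up_def down_def elim: grid_arcD[OF G])
    then have "card (N x \<inter> V) \<le> card (up x \<union> down x)"
      using card_ud by (intro card_mono) auto
    also have "\<dots> \<le> card (up x) + card (down x)" by (rule card_Un_le)
    finally show ?thesis using card_ud[of x] by simp
  qed
  have degen: "\<exists>x\<in>U. card (N x \<inter> U) \<le> d" if U: "U \<subseteq> V" "U \<noteq> {}" for U
  proof -
    have "finite U" using U finV finite_subset by blast
    then have "Max (sum_list ` U) \<in> sum_list ` U" "\<And>y. y \<in> U \<Longrightarrow> sum_list y \<le> Max (sum_list ` U)"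
      using U(2) by simp_all
    then obtain x where x: "x \<in> U" and max: "\<And>y. y \<in> U \<Longrightarrow> sum_list y \<le> sum_list x"
      by auto
    \<comment> \<open>An upward neighbour in \<open>U\<close> would have a larger coordinate sum
      than the maximal one of \<open>x\<close>.\<close>
    have "N x \<inter> U \<subseteq> down x"
    proof
      fix y assume y: "y \<in> N x \<inter> U"
      then have "(x, y) \<in> parcs G" by (simp add: N_def)
      then show "y \<in> down x"
        using max[of y] y ns(1) by (auto simp: down_def elim: grid_arcD[OF G])
    qed
    then have "card (N x \<inter> U) \<le> card (down x)" using card_ud by (intro card_mono)
    then have "card (N x \<inter> U) \<le> d" using card_ud(2)[of x] by linarith
    then show ?thesis using x by blast
  qed
  have "\<exists>c. valid V c"
    using L deg degen assms(2,3)
    by (intro equitable_colouring_exists[OF finV card_V, of "2 * d" d])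
      (auto simp: uniform_list_assignment_def V_def)
  then obtain c where c: "valid V c" ..
  have cls: "cls V c a = colour_class G c a" for a
    by (simp add: cls_def colour_class_def V_def)
  have "int (card (colour_class G c a)) \<le> \<lceil>real (card (pverts G)) / real k\<rceil>" for a
  proof -
    have "card (colour_class G c a) \<le> s" using c by (simp add: valid_def cls)
    then show ?thesis using s by (simp add: s_def V_def nat_le_iff le_nat_iff)
  qed
  then show "\<exists>c. list_colouring G L c \<and> equitable_colouring k G c \<and>
      (\<forall>a. acyclic_graph (with_proj G \<restriction> colour_class G c a))"
    using c by (intro exI[of _ c])
      (auto simp: valid_def cls list_colouring_def equitable_colouring_def simp flip: V_def)
qed

theorem theorem14:
  fixes d k :: nat
  shows "(8 \<le> k \<longrightarrow>
            (\<forall>G. is_grid 5 G \<longrightarrow> equitably_list_arborable TYPE('c) k G))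
       \<and> (6 \<le> d \<and> d \<le> 16 \<and> real k \<ge> 2 * real d - 2 + (2 * real d - 4) / 7 \<longrightarrow>
            (\<forall>G. is_grid d G \<longrightarrow> equitably_list_arborable TYPE('c) k G))
       \<and> (17 \<le> d \<and> real k \<ge> 2 * real d - 3 + (2 * real d - 3) / 6 \<longrightarrow>
            (\<forall>G. is_grid d G \<longrightarrow> equitably_list_arborable TYPE('c) k G))"
proof (intro conjI impI allI)
  \<comment> \<open>For dimension 5, \<open>15 \<le> 16\<close>. In the other cases
    \<open>2 * d - 2\<close> (for \<open>d \<ge> 6\<close>) and \<open>2 * d - 3\<close> (for
    \<open>d \<ge> 17\<close>) already exceed \<open>3 * d / 2\<close>.\<close>
  fix G assume "8 \<le> k" "is_grid 5 G"
  then show "equitably_list_arborable TYPE('c) k G"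
    by (intro grid_equitably_list_arborable[of 5]) auto
next
  fix G assume "6 \<le> d \<and> d \<le> 16 \<and> real k \<ge> 2 * real d - 2 + (2 * real d - 4) / 7" "is_grid d G"
  then show "equitably_list_arborable TYPE('c) k G"
    by (intro grid_equitably_list_arborable[of d]) (auto simp: field_simps)
next
  fix G assume "17 \<le> d \<and> real k \<ge> 2 * real d - 3 + (2 * real d - 3) / 6" "is_grid d G"
  then show "equitably_list_arborable TYPE('c) k G"
    by (intro grid_equitably_list_arborable[of d]) (auto simp: field_simps)
qed

end
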